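(* Let $G$ be a connected graph with vertex set $\{1,\dots,n\}$, $n\ge 2$, let $\Phi=(F_1,\dots,F_n)$ be an $n$-tuple of pairwise disjoint graphs with $\delta(F_i)\ge 1$ for all $i$, and let $G[\Phi]$ be the generalized lexicographic product. Then $G[\Phi]$ is well $\gamma_t$-dominated if and only if $G$ is complete and, for all $i\in[n]$, $F_i$ is well $\gamma_t$-dominated with $\gamma_t(F_i)=2$. Moreover, if $G[\Phi]$ is well $\gamma_t$-dominated, then $\gamma_t(G[\Phi])=2$.
   Context: All graphs are finite, simple and undirected; $\delta(H)$ is the minimum degree. The generalized lexicographic product $G[\Phi]$ is the graph with vertex set $\bigcup_{i=1}^n V(F_i)$ in which each $F_i$ is an induced subgraph, and for $x\in V(F_i)$, $y\in V(F_j)$ with $i\neq j$, $xy$ is an edge iff $ij\in E(G)$. A total dominating set of $H$ is a set $S$ such that every vertex of $H$ has a neighbor in $S$; it is minimal if no proper subset is total dominating. $\gamma_t(H)$ is the minimum and $\Gamma_t(H)$ the maximum cardinality of a minimal total dominating set; $H$ is well $\gamma_t$-dominated if $\gamma_t(H)=\Gamma_t(H)$. *)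

theory Defs
  imports "Graph_Theory.Graph_Theory" "HOL-Library.Disjoint_Sets"
begin

text \<open>
  A finite simple undirected graph is a \<^locale>\<open>pair_graph\<close>: finite, loop-free, and with a
  symmetric arc relation, so that an edge \<open>uv\<close> is the pair of arcs \<open>(u, v)\<close>, \<open>(v, u)\<close>.
  By symmetry the out-degree is the usual degree.
\<close>

definition min_degree :: "'a pair_pre_digraph \<Rightarrow> nat" where
  "min_degree H = Min (out_degree (with_proj H) ` pverts H)"

definition total_dominating :: "'a pair_pre_digraph \<Rightarrow> 'a set \<Rightarrow> bool" where
  "total_dominating H S \<longleftrightarrow> S \<subseteq> pverts H \<and> (\<forall>v\<in>pverts H. \<exists>u\<in>S. (v, u) \<in> parcs H)"

definition minimal_total_dominating :: "'a pair_pre_digraph \<Rightarrow> 'a set \<Rightarrow> bool" where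
  "minimal_total_dominating H S \<longleftrightarrow>
     total_dominating H S \<and> (\<forall>T. T \<subset> S \<longrightarrow> \<not> total_dominating H T)"

text \<open>
  The next two parameters are meaningful only for finite graphs without isolated vertices:
  otherwise there is no total dominating set and \<^const>\<open>Min\<close>, \<^const>\<open>Max\<close> are applied to
  the empty set.
\<close>

definition total_domination_number :: "'a pair_pre_digraph \<Rightarrow> nat" (\<open>\<gamma>\<^sub>t\<close>) where
  "\<gamma>\<^sub>t H = Min (card ` {S. minimal_total_dominating H S})"

definition upper_total_domination_number :: "'a pair_pre_digraph \<Rightarrow> nat" (\<open>\<Gamma>\<^sub>t\<close>) where
  "\<Gamma>\<^sub>t H = Max (card ` {S. minimal_total_dominating H S})"

definition well_total_dominated :: "'a pair_pre_digraph \<Rightarrow> bool" where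
  "well_total_dominated H \<longleftrightarrow> \<gamma>\<^sub>t H = \<Gamma>\<^sub>t H"

definition gen_lex_product ::
    "'i pair_pre_digraph \<Rightarrow> ('i \<Rightarrow> 'a pair_pre_digraph) \<Rightarrow> 'a pair_pre_digraph" where
  "gen_lex_product G \<Phi> =
     \<lparr> pverts = (\<Union>i\<in>pverts G. pverts (\<Phi> i)),
       parcs = (\<Union>i\<in>pverts G. parcs (\<Phi> i)) \<union>
               (\<Union>(i, j)\<in>parcs G. pverts (\<Phi> i) \<times> pverts (\<Phi> j)) \<rparr>"

lemma pair_graph_gen_lex_product:
  assumes G: "pair_graph G" and F: "\<And>i. i \<in> pverts G \<Longrightarrow> pair_graph (\<Phi> i)"
    and disj: "disjoint_family_on (\<lambda>i. pverts (\<Phi> i)) (pverts G)"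
  shows "pair_graph (gen_lex_product G \<Phi>)"
proof -
  interpret G: pair_graph G by (rule G)
  let ?P = "gen_lex_product G \<Phi>"
  have Fv: "(x, y) \<in> parcs (\<Phi> i) \<Longrightarrow> x \<in> pverts (\<Phi> i) \<and> y \<in> pverts (\<Phi> i) \<and> x \<noteq> y
      \<and> (y, x) \<in> parcs (\<Phi> i)" if "i \<in> pverts G" for i x y
  proof -
    interpret F: pair_graph "\<Phi> i" using F that .
    show "(x, y) \<in> parcs (\<Phi> i) \<Longrightarrow> ?thesis"
      by (auto dest: F.in_arcsD1 F.in_arcsD2 F.no_loops' F.arcs_symmetric)
  qed
  have Gv: "i \<in> pverts G \<and> j \<in> pverts G \<and> i \<noteq> j \<and> (j, i) \<in> parcs G"
    if "(i, j) \<in> parcs G" for i j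
    using that by (auto dest: G.in_arcsD1 G.in_arcsD2 G.no_loops' G.arcs_symmetric)
  have arcs: "x \<in> pverts ?P \<and> y \<in> pverts ?P \<and> x \<noteq> y \<and> (y, x) \<in> parcs ?P"
    if "(x, y) \<in> parcs ?P" for x y
  proof -
    from that consider (inner) i where "i \<in> pverts G" "(x, y) \<in> parcs (\<Phi> i)"
      | (outer) i j where "(i, j) \<in> parcs G" "x \<in> pverts (\<Phi> i)" "y \<in> pverts (\<Phi> j)"
      by (auto simp: gen_lex_product_def)
    then show ?thesis
    proof cases
      case inner
      then show ?thesis using Fv[of i x y] by (auto simp: gen_lex_product_def)
    next
      case outer
      with Gv[of i j] disj have "x \<noteq> y" by (auto simp: disjoint_family_on_def)
      with outer Gv[of i j] show ?thesis by (auto simp: gen_lex_product_def)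
    qed
  qed
  have fin: "finite (pverts ?P)"
    using G.pair_finite_verts F
    by (auto simp: gen_lex_product_def pair_graph_def pair_digraph_def pair_fin_digraph_def
        pair_fin_digraph_axioms_def)
  have "parcs ?P \<subseteq> pverts ?P \<times> pverts ?P" using arcs by auto
  then have "finite (parcs ?P)" using fin by (meson finite_SigmaI finite_subset)
  with fin arcs show ?thesis
    by unfold_locales (auto simp: symmetric_def intro!: symI)
qed

lemma induced_subgraph_gen_lex_product:
  assumes G: "pair_graph G" and F: "\<And>i. i \<in> pverts G \<Longrightarrow> pair_graph (\<Phi> i)"
    and disj: "disjoint_family_on (\<lambda>i. pverts (\<Phi> i)) (pverts G)" and i: "i \<in> pverts G"
  shows "induced_subgraph (with_proj (\<Phi> i)) (with_proj (gen_lex_product G \<Phi>))"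
proof -
  let ?P = "gen_lex_product G \<Phi>"
  interpret G: pair_graph G by (rule G)
  interpret P: pair_graph ?P using G F disj by (rule pair_graph_gen_lex_product)
  interpret Fi: pair_graph "\<Phi> i" using F i .
  have same: "k = i" if "x \<in> pverts (\<Phi> k)" "x \<in> pverts (\<Phi> i)" "k \<in> pverts G" for k x
    using that disj i by (auto simp: disjoint_family_on_def)
  have "(x, y) \<in> parcs (\<Phi> i)"
    if "(x, y) \<in> parcs ?P" and x: "x \<in> pverts (\<Phi> i)" and y: "y \<in> pverts (\<Phi> i)" for x y
  proof -
    from that(1) consider (inner) k where "k \<in> pverts G" "(x, y) \<in> parcs (\<Phi> k)"
      | (outer) k l where "(k, l) \<in> parcs G" "x \<in> pverts (\<Phi> k)" "y \<in> pverts (\<Phi> l)"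
      by (auto simp: gen_lex_product_def)
    then show ?thesis
    proof cases
      case inner
      interpret Fk: pair_graph "\<Phi> k" using F inner(1) .
      show ?thesis using inner x same[of x k] by (auto dest: Fk.in_arcsD1)
    next
      case outer
      then have "k = i" "l = i"
        using same x y by (auto dest: G.in_arcsD1 G.in_arcsD2)
      with outer(1) show ?thesis by (auto dest: G.no_loops')
    qed
  qed
  moreover have "pverts (\<Phi> i) \<subseteq> pverts ?P" "parcs (\<Phi> i) \<subseteq> parcs ?P"
    using i by (auto simp: gen_lex_product_def)
  ultimately show ?thesis
    unfolding induced_subgraph_def subgraph_def
    using P.wf_digraph_axioms Fi.wf_digraph_axioms
    by (auto dest: Fi.in_arcsD1 Fi.in_arcsD2)
qed

end

theory Submission
  imports Defs
begin

text \<open>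
  Choose a minimal total dominating set \<open>S\<^sub>i\<close> of every factor \<open>F\<^sub>i\<close>. For each maximal
  independent set \<open>I\<close> of \<open>G\<close>, the union of the \<open>S\<^sub>i\<close> with \<open>i \<in> I\<close> is a minimal total dominating
  set of the product. If \<open>G\<close> is not complete, it contains an induced path \<open>a - b - c\<close>; extend
  \<open>{a, c}\<close> to a maximal independent set \<open>I\<close> and let \<open>A\<close> be the set of neighbours of \<open>b\<close> in \<open>I\<close>,
  so that \<open>|A| \<ge> 2\<close>. Replacing the sets \<open>S\<^sub>i\<close>, \<open>i \<in> A\<close>, which have at least \<open>2|A|\<close> elements
  altogether, by one vertex from each \<open>F\<^sub>i\<close>, \<open>i \<in> A \<union> {b}\<close>, yields a total dominating set that is
  strictly smaller, so the product is not well dominated. If \<open>G\<close> is complete, then two vertices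
  from different factors always form a total dominating set, and the remaining minimal total
  dominating sets of the product are exactly those of the single factors.
\<close>

section \<open>Finite graphs and their minimal total dominating sets\<close>

lemma pair_graph_finite_pverts: "pair_graph H \<Longrightarrow> finite (pverts H)"
  unfolding pair_graph_def pair_digraph_def by (blast dest: pair_fin_digraph.pair_finite_verts)

lemma pair_graph_arcsD:
  assumes "pair_graph H" "(u, v) \<in> parcs H"
  shows "u \<in> pverts H" "v \<in> pverts H" "u \<noteq> v" "(v, u) \<in> parcs H"
proof -
  have "pair_digraph H" "pair_pseudo_graph H" using assms(1) unfolding pair_graph_def by blast+
  then have "pair_wf_digraph H" "pair_loopfree_digraph H" "pair_sym_digraph H"
    unfolding pair_digraph_def pair_pseudo_graph_def pair_loopfree_digraph_def by blast+
  note * = pair_wf_digraph.arc_fst_in_verts[OF this(1)] pair_wf_digraph.arc_snd_in_verts[OF this(1)]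
    pair_loopfree_digraph.pair_no_loops[OF this(2)] pair_sym_digraph.pair_sym_arcs[OF this(3)]
  show "u \<in> pverts H" "v \<in> pverts H" "u \<noteq> v" using *(1-3)[OF assms(2)] by simp_all
  show "(v, u) \<in> parcs H" using arcs_ends_symmetric[OF *(4)] assms(2) by simp
qed

lemma total_dominating_pverts:
  assumes "pair_graph H" "\<And>v. v \<in> pverts H \<Longrightarrow> \<exists>u. (v, u) \<in> parcs H"
  shows "total_dominating H (pverts H)"
  using assms(2) pair_graph_arcsD(2)[OF assms(1)] unfolding total_dominating_def by blast

lemma minimal_total_dominating_subset_exists:
  assumes "pair_graph H" "total_dominating H T"
  obtains S where "minimal_total_dominating H S" "S \<subseteq> T"
proof -
  have "finite {S. total_dominating H S \<and> S \<subseteq> T}"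
    by (rule finite_subset[of _ "Pow (pverts H)"])
       (auto simp: total_dominating_def pair_graph_finite_pverts[OF assms(1)])
  then obtain S where "S \<in> {S. total_dominating H S \<and> S \<subseteq> T}"
    and "\<forall>R \<in> {S. total_dominating H S \<and> S \<subseteq> T}. R \<subseteq> S \<longrightarrow> S = R"
    using finite_has_minimal[of "{S. total_dominating H S \<and> S \<subseteq> T}"] assms(2) by blast
  then have "minimal_total_dominating H S" "S \<subseteq> T"
    unfolding minimal_total_dominating_def by auto
  then show thesis by (rule that)
qed

lemma finite_minimal_total_dominating:
  assumes "pair_graph H"
  shows "finite {S. minimal_total_dominating H S}"
  by (rule finite_subset[of _ "Pow (pverts H)"])
     (auto simp: minimal_total_dominating_def total_dominating_def pair_graph_finite_pverts[OF assms])

text \<open>Some vertex must be dominated, so \<open>S\<close> has a member; this member itself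
  needs a neighbour in \<open>S\<close>, which differs from it because there are no loops.\<close>

lemma card_total_dominating_ge_2:
  assumes "pair_graph H" "pverts H \<noteq> {}" "total_dominating H S"
  shows "2 \<le> card S"
proof -
  obtain v where "v \<in> pverts H" using assms(2) by blast
  then obtain u where u: "u \<in> S" using assms(3) unfolding total_dominating_def by blast
  then obtain w where w: "w \<in> S" "(u, w) \<in> parcs H"
    using assms(3) unfolding total_dominating_def by blast
  then have "u \<noteq> w" using pair_graph_arcsD(3)[OF assms(1)] by blast
  moreover have "finite S"
    using assms(3) pair_graph_finite_pverts[OF assms(1)] finite_subset unfolding total_dominating_def by blast
  ultimately show ?thesis using u w card_mono[of S "{u, w}"] by auto
qed

text \<open>Minimum and maximum of a finite nonempty set of sizes agree exactly when all the sizes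
  are equal. The set \<open>T\<close> guarantees that a minimal total dominating set exists, so that
  \<open>Min\<close> and \<open>Max\<close> are not applied to the empty set. Taking
  \<open>k\<close> to be \<open>\<gamma>\<^sub>t H\<close> turns well-domination into equal
  cardinality of all minimal sets.\<close>

lemma well_total_dominated_iff_card:
  assumes "pair_graph H" "total_dominating H T"
  shows "well_total_dominated H \<and> \<gamma>\<^sub>t H = k \<longleftrightarrow>
    (\<forall>S. minimal_total_dominating H S \<longrightarrow> card S = k)"
proof -
  let ?C = "card ` {S. minimal_total_dominating H S}"
  have fin: "finite ?C" using finite_minimal_total_dominating[OF assms(1)] by blast
  have ne: "?C \<noteq> {}" using minimal_total_dominating_subset_exists[OF assms] by blast
  have "Min ?C = Max ?C \<and> Min ?C = k \<longleftrightarrow> (\<forall>c\<in>?C. c = k)"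
  proof
    assume *: "Min ?C = Max ?C \<and> Min ?C = k"
    show "\<forall>c\<in>?C. c = k"
    proof
      fix c assume "c \<in> ?C"
      then show "c = k" using Min_le[OF fin, of c] Max_ge[OF fin, of c] * by linarith
    qed
  next
    assume "\<forall>c\<in>?C. c = k"
    then show "Min ?C = Max ?C \<and> Min ?C = k" using Min_in[OF fin ne] Max_in[OF fin ne] by metis
  qed
  then show ?thesis
    unfolding well_total_dominated_def total_domination_number_def
      upper_total_domination_number_def by blast
qed

lemma min_degree_ge_1_imp_adjacent:
  assumes "pair_graph H" "min_degree H \<ge> 1" "v \<in> pverts H"
  shows "\<exists>u. (v, u) \<in> parcs H"
proof -
  have "min_degree H \<le> out_degree (with_proj H) v"
    unfolding min_degree_def using assms(3) pair_graph_finite_pverts[OF assms(1)] by (intro Min_le) auto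
  then have "out_arcs (with_proj H) v \<noteq> {}"
    using assms(2) unfolding out_degree_def by (metis card.empty not_one_le_zero order_trans)
  then show ?thesis unfolding out_arcs_def by auto
qed

section \<open>Induced paths and maximal independent sets in the base graph\<close>

text \<open>Without an induced path on three vertices, "equal or adjacent" is a transitive relation,
  so connectedness would make any two distinct vertices adjacent.\<close>

lemma induced_path_exists:
  assumes "pair_graph G" "Digraph_Component.connected (with_proj G)"
    and "u \<in> pverts G" "v \<in> pverts G" "u \<noteq> v" "(u, v) \<notin> parcs G"
  shows "\<exists>a b c. (a, b) \<in> parcs G \<and> (b, c) \<in> parcs G \<and> a \<noteq> c \<and> (a, c) \<notin> parcs G"
proof (rule ccontr)
  assume no_path: "\<not> ?thesis"
  \<comment> \<open>\<open>connected\<close> is defined through the symmetric closure, which leaves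
    a symmetric arc set unchanged.\<close>
  have arcs: "parcs (mk_symmetric (with_proj G)) = parcs G"
    using pair_graph_arcsD(4)[OF assms(1)] by (auto simp: parcs_mk_symmetric)
  have "u \<rightarrow>\<^sup>*\<^bsub>with_proj (mk_symmetric (with_proj G))\<^esub> v"
    using assms(2-4) unfolding connected_def strongly_connected_def by simp
  from reachable_rtranclI[OF this] have "(u, v) \<in> (parcs G)\<^sup>*" by (simp add: arcs)
  then have "u = v \<or> (u, v) \<in> parcs G"
    \<comment> \<open>If \<open>u\<close> equals or is adjacent to the current vertex of the walk,
      the same holds for the next one; otherwise these three vertices would form an induced
      path.\<close>
    by induction (use no_path in auto)
  with assms(5,6) show False by blast
qed

text \<open>Maximality is delivered in the form of domination: an outside vertex without a neighbour
  in \<open>I\<close> could be added to \<open>I\<close> without destroying independence.\<close>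

lemma maximal_independent_extension:
  assumes "pair_graph G" "J \<subseteq> pverts G" "\<And>i j. i \<in> J \<Longrightarrow> j \<in> J \<Longrightarrow> (i, j) \<notin> parcs G"
  obtains I where "J \<subseteq> I" "I \<subseteq> pverts G" "\<And>i j. i \<in> I \<Longrightarrow> j \<in> I \<Longrightarrow> (i, j) \<notin> parcs G"
    "\<And>j. j \<in> pverts G - I \<Longrightarrow> \<exists>i\<in>I. (j, i) \<in> parcs G"
proof -
  let ?C = "{I. J \<subseteq> I \<and> I \<subseteq> pverts G \<and> (\<forall>i\<in>I. \<forall>j\<in>I. (i, j) \<notin> parcs G)}"
  have "finite ?C"
    by (rule finite_subset[of _ "Pow (pverts G)"]) (auto simp: pair_graph_finite_pverts[OF assms(1)])
  moreover have "J \<in> ?C" using assms(2,3) by blast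
  ultimately have "\<exists>I\<in>?C. \<forall>K\<in>?C. I \<subseteq> K \<longrightarrow> I = K"
    by (intro finite_has_maximal) blast+
  then obtain I where I: "I \<in> ?C" and max: "\<And>K. K \<in> ?C \<Longrightarrow> I \<subseteq> K \<Longrightarrow> I = K" by meson
  have "\<exists>i\<in>I. (j, i) \<in> parcs G" if j: "j \<in> pverts G - I" for j
  proof (rule ccontr)
    assume none: "\<not> (\<exists>i\<in>I. (j, i) \<in> parcs G)"
    then have "\<forall>i\<in>I. (i, j) \<notin> parcs G" using pair_graph_arcsD(4)[OF assms(1)] by blast
    moreover have "(j, j) \<notin> parcs G" using pair_graph_arcsD(3)[OF assms(1)] by blast
    ultimately have "insert j I \<in> ?C" using I j none by auto
    from max[OF this] j show False by blast
  qed
  with I show thesis by (intro that[of I]) auto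
qed

section \<open>Adjacency and total domination in the product\<close>

text \<open>The degree condition enters as the absence of isolated vertices, which makes the whole
  vertex set of a factor total dominating, so that minimal total dominating sets exist.\<close>

locale lex_product =
  fixes G :: "'i pair_pre_digraph" and \<Phi> :: "'i \<Rightarrow> 'a pair_pre_digraph"
  assumes base_graph: "pair_graph G"
    and factor_graph: "\<And>i. i \<in> pverts G \<Longrightarrow> pair_graph (\<Phi> i)"
    and factor_nonempty: "\<And>i. i \<in> pverts G \<Longrightarrow> pverts (\<Phi> i) \<noteq> {}"
    and factors_disjoint: "disjoint_family_on (\<lambda>i. pverts (\<Phi> i)) (pverts G)"
    and factor_no_isolated:
      "\<And>i v. i \<in> pverts G \<Longrightarrow> v \<in> pverts (\<Phi> i) \<Longrightarrow> \<exists>u. (v, u) \<in> parcs (\<Phi> i)"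
begin

lemmas base_arcsD = pair_graph_arcsD[OF base_graph]

lemma base_no_loops: "(i, i) \<notin> parcs G"
  using base_arcsD(3) by blast

abbreviation P :: "'a pair_pre_digraph" where "P \<equiv> gen_lex_product G \<Phi>"

lemma product_graph: "pair_graph P"
  by (rule pair_graph_gen_lex_product) (use base_graph factor_graph factors_disjoint in auto)

lemma pverts_product: "pverts P = (\<Union>i\<in>pverts G. pverts (\<Phi> i))"
  by (simp add: gen_lex_product_def)

lemma same_factor:
  "x \<in> pverts (\<Phi> i) \<Longrightarrow> x \<in> pverts (\<Phi> j) \<Longrightarrow> i \<in> pverts G \<Longrightarrow> j \<in> pverts G \<Longrightarrow> i = j"
  using factors_disjoint by (auto simp: disjoint_family_on_def)

text \<open>Disjointness of the factors makes the index of a vertex unique, so adjacency can be read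
  off from the factors containing the two endpoints.\<close>

lemma parcs_product_iff:
  assumes i: "i \<in> pverts G" and j: "j \<in> pverts G"
    and x: "x \<in> pverts (\<Phi> i)" and y: "y \<in> pverts (\<Phi> j)"
  shows "(x, y) \<in> parcs P \<longleftrightarrow> i = j \<and> (x, y) \<in> parcs (\<Phi> i) \<or> (i, j) \<in> parcs G"
proof
  assume "(x, y) \<in> parcs P"
  then consider (inner) k where "k \<in> pverts G" "(x, y) \<in> parcs (\<Phi> k)"
    | (outer) k l where "(k, l) \<in> parcs G" "x \<in> pverts (\<Phi> k)" "y \<in> pverts (\<Phi> l)"
    by (auto simp: gen_lex_product_def)
  then show "i = j \<and> (x, y) \<in> parcs (\<Phi> i) \<or> (i, j) \<in> parcs G"
  proof cases
    case inner
    have "x \<in> pverts (\<Phi> k)" "y \<in> pverts (\<Phi> k)"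
      using inner(2) pair_graph_arcsD(1,2)[OF factor_graph[OF inner(1)]] by blast+
    then have "k = i" "k = j" using same_factor inner(1) assms by blast+
    with inner(2) show ?thesis by blast
  next
    case outer
    then have "k = i" "l = j"
      using same_factor assms base_arcsD(1,2) by blast+
    with outer(1) show ?thesis by blast
  qed
next
  assume "i = j \<and> (x, y) \<in> parcs (\<Phi> i) \<or> (i, j) \<in> parcs G"
  then show "(x, y) \<in> parcs P" using assms by (auto simp: gen_lex_product_def)
qed

lemma product_no_isolated: "v \<in> pverts P \<Longrightarrow> \<exists>u. (v, u) \<in> parcs P"
  using factor_no_isolated unfolding gen_lex_product_def by fastforce

lemma factor_total_dominating:
  "i \<in> pverts G \<Longrightarrow> total_dominating (\<Phi> i) (pverts (\<Phi> i))"
  using total_dominating_pverts factor_graph factor_no_isolated by blast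

text \<open>A single vertex of \<open>\<Phi> i\<close> is adjacent to all vertices of the other
  factors, since \<open>i\<close> is adjacent to every other index. What remains is domination
  inside \<open>\<Phi> i\<close>, where the product adds no arcs because \<open>G\<close> has no
  loops.\<close>

lemma total_dominating_product_in_factor_iff:
  assumes i: "i \<in> pverts G" and universal: "\<And>j. j \<in> pverts G \<Longrightarrow> j \<noteq> i \<Longrightarrow> (j, i) \<in> parcs G"
    and S: "S \<subseteq> pverts (\<Phi> i)"
  shows "total_dominating P S \<longleftrightarrow> total_dominating (\<Phi> i) S"
proof
  assume td: "total_dominating P S"
  show "total_dominating (\<Phi> i) S"
    unfolding total_dominating_def
  proof (intro conjI ballI)
    fix v assume v: "v \<in> pverts (\<Phi> i)"
    then obtain u where u: "u \<in> S" "(v, u) \<in> parcs P"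
      using td i unfolding total_dominating_def pverts_product by blast
    then have "(v, u) \<in> parcs (\<Phi> i)"
      using parcs_product_iff[OF i i v] S by (auto simp: base_no_loops)
    with u show "\<exists>u\<in>S. (v, u) \<in> parcs (\<Phi> i)" by blast
  qed (rule S)
next
  assume td: "total_dominating (\<Phi> i) S"
  obtain s where s: "s \<in> S"
    using td factor_nonempty[OF i] unfolding total_dominating_def by blast
  show "total_dominating P S"
    unfolding total_dominating_def
  proof (intro conjI ballI)
    show "S \<subseteq> pverts P" using S i by (auto simp: pverts_product)
    fix v assume "v \<in> pverts P"
    then obtain j where j: "j \<in> pverts G" "v \<in> pverts (\<Phi> j)" by (auto simp: pverts_product)
    show "\<exists>u\<in>S. (v, u) \<in> parcs P"
    proof (cases "j = i")
      case True
      then obtain u where "u \<in> S" "(v, u) \<in> parcs (\<Phi> i)"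
        using td j unfolding total_dominating_def by blast
      then show ?thesis using i by (auto simp: gen_lex_product_def)
    next
      case False
      then have "(v, s) \<in> parcs P"
        using parcs_product_iff[OF j(1) i j(2)] universal[OF j(1)] s S by blast
      with s show ?thesis by blast
    qed
  qed
qed

lemma minimal_total_dominating_product_in_factor_iff:
  assumes "i \<in> pverts G" "\<And>j. j \<in> pverts G \<Longrightarrow> j \<noteq> i \<Longrightarrow> (j, i) \<in> parcs G"
    and "S \<subseteq> pverts (\<Phi> i)"
  shows "minimal_total_dominating P S \<longleftrightarrow> minimal_total_dominating (\<Phi> i) S"
  unfolding minimal_total_dominating_def
  using total_dominating_product_in_factor_iff[OF assms(1,2)] assms(3)
  by (metis order.trans psubset_imp_subset)

text \<open>Every index \<open>k\<close> differs from \<open>i\<close> or from \<open>j\<close>, so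
  each vertex of \<open>\<Phi> k\<close> is adjacent to \<open>x\<close> or to
  \<open>y\<close>.\<close>

lemma total_dominating_cross_pair:
  assumes complete: "\<And>i j. i \<in> pverts G \<Longrightarrow> j \<in> pverts G \<Longrightarrow> i \<noteq> j \<Longrightarrow> (i, j) \<in> parcs G"
    and "i \<in> pverts G" "j \<in> pverts G" "i \<noteq> j" "x \<in> pverts (\<Phi> i)" "y \<in> pverts (\<Phi> j)"
  shows "total_dominating P {x, y}"
  unfolding total_dominating_def
proof (intro conjI ballI)
  show "{x, y} \<subseteq> pverts P" using assms(2-) by (auto simp: pverts_product)
  fix v assume "v \<in> pverts P"
  then obtain k where k: "k \<in> pverts G" "v \<in> pverts (\<Phi> k)" by (auto simp: pverts_product)
  show "\<exists>u\<in>{x, y}. (v, u) \<in> parcs P"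
    using parcs_product_iff[OF k(1) assms(2) k(2) assms(5)]
      parcs_product_iff[OF k(1) assms(3) k(2) assms(6)]
      complete[OF k(1) assms(2)] complete[OF k(1) assms(3)] assms(4) by blast
qed

section \<open>Unequal sizes over a non-complete base graph\<close>

text \<open>Maximality of \<open>I\<close> takes care of the factors outside \<open>I\<close>.
  Independence gives minimality: a vertex of \<open>\<Phi> i\<close> with \<open>i \<in> I\<close>
  has no neighbours in the union except in \<open>S i\<close>, so nothing can be removed from
  \<open>S i\<close>.\<close>

lemma minimal_total_dominating_UN_maximal_independent:
  assumes I: "I \<subseteq> pverts G" and indep: "\<And>i j. i \<in> I \<Longrightarrow> j \<in> I \<Longrightarrow> (i, j) \<notin> parcs G"
    and maximal: "\<And>j. j \<in> pverts G - I \<Longrightarrow> \<exists>i\<in>I. (j, i) \<in> parcs G"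
    and S: "\<And>i. i \<in> I \<Longrightarrow> minimal_total_dominating (\<Phi> i) (S i)"
  shows "minimal_total_dominating P (\<Union>i\<in>I. S i)"
proof -
  have S_sub: "S i \<subseteq> pverts (\<Phi> i)" and S_td: "total_dominating (\<Phi> i) (S i)" if "i \<in> I" for i
    using S[OF that] unfolding minimal_total_dominating_def total_dominating_def by auto
  have "total_dominating P (\<Union>i\<in>I. S i)"
    unfolding total_dominating_def
  proof (intro conjI ballI)
    show "(\<Union>i\<in>I. S i) \<subseteq> pverts P" using S_sub I by (fastforce simp: pverts_product)
    fix v assume "v \<in> pverts P"
    then obtain j where j: "j \<in> pverts G" "v \<in> pverts (\<Phi> j)" by (auto simp: pverts_product)
    show "\<exists>u\<in>\<Union>i\<in>I. S i. (v, u) \<in> parcs P"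
    proof (cases "j \<in> I")
      case True
      then obtain u where "u \<in> S j" "(v, u) \<in> parcs (\<Phi> j)"
        using S_td[OF True] j unfolding total_dominating_def by blast
      then show ?thesis using True j by (auto simp: gen_lex_product_def)
    next
      case False
      then obtain i where i: "i \<in> I" "(j, i) \<in> parcs G" using maximal j by blast
      then obtain u where u: "u \<in> S i"
        using S_td[of i] factor_nonempty[of i] I unfolding total_dominating_def by blast
      then have "(v, u) \<in> parcs P"
        using parcs_product_iff[of j i v u] i j I S_sub[of i] by blast
      with u i show ?thesis by blast
    qed
  qed
  moreover have "\<not> total_dominating P T" if T: "T \<subset> (\<Union>i\<in>I. S i)" for T
  proof
    assume td: "total_dominating P T"
    from T obtain x i where x: "i \<in> I" "x \<in> S i" "x \<notin> T" by blast
    have iG: "i \<in> pverts G" using x(1) I by blast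
    \<comment> \<open>The part of \<open>T\<close> in the factor that lost \<open>x\<close> would
      have to dominate this factor alone, contradicting the minimality of
      \<open>S i\<close>.\<close>
    have "total_dominating (\<Phi> i) (T \<inter> S i)"
      unfolding total_dominating_def
    proof (intro conjI ballI)
      show "T \<inter> S i \<subseteq> pverts (\<Phi> i)" using S_sub[OF x(1)] by blast
      fix v assume v: "v \<in> pverts (\<Phi> i)"
      then obtain u where u: "u \<in> T" "(v, u) \<in> parcs P"
        using td iG unfolding total_dominating_def pverts_product by blast
      then obtain k where k: "k \<in> I" "u \<in> S k" using T by blast
      then have "i = k \<and> (v, u) \<in> parcs (\<Phi> i)"
        using parcs_product_iff[of i k v u] iG v u(2) I S_sub[of k] indep[OF x(1), of k] by blast
      with u k show "\<exists>u\<in>T \<inter> S i. (v, u) \<in> parcs (\<Phi> i)" by blast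
    qed
    moreover have "T \<inter> S i \<subset> S i" using x by blast
    ultimately show False using S[OF x(1)] unfolding minimal_total_dominating_def by blast
  qed
  ultimately show ?thesis unfolding minimal_total_dominating_def by blast
qed

lemma induced_path_imp_smaller_total_dominating:
  assumes ab: "(a, b) \<in> parcs G" and bc: "(b, c) \<in> parcs G" and "a \<noteq> c" "(a, c) \<notin> parcs G"
  obtains S T where "minimal_total_dominating P S" "total_dominating P T" "card T < card S"
proof -
  have abc: "a \<in> pverts G" "b \<in> pverts G" "c \<in> pverts G"
    using ab bc base_arcsD(1,2) by blast+
  have "(i, j) \<notin> parcs G" if "i \<in> {a, c}" "j \<in> {a, c}" for i j
    using that assms(4) base_arcsD(4) base_no_loops by blast
  then obtain I where ac: "{a, c} \<subseteq> I" and I: "I \<subseteq> pverts G"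
    and indep: "\<And>i j. i \<in> I \<Longrightarrow> j \<in> I \<Longrightarrow> (i, j) \<notin> parcs G"
    and maximal: "\<And>j. j \<in> pverts G - I \<Longrightarrow> \<exists>i\<in>I. (j, i) \<in> parcs G"
    using maximal_independent_extension[OF base_graph, of "{a, c}"] abc by auto
  have "\<exists>S. minimal_total_dominating (\<Phi> i) S" if "i \<in> pverts G" for i
    using minimal_total_dominating_subset_exists[OF factor_graph factor_total_dominating] that
    by blast
  then obtain S where S: "\<And>i. i \<in> pverts G \<Longrightarrow> minimal_total_dominating (\<Phi> i) (S i)" by metis
  have S_td: "total_dominating (\<Phi> i) (S i)" and S_sub: "S i \<subseteq> pverts (\<Phi> i)"
    if "i \<in> pverts G" for i
    using S[OF that] unfolding minimal_total_dominating_def total_dominating_def by auto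
  have "\<exists>y. y \<in> pverts (\<Phi> i)" if "i \<in> pverts G" for i using factor_nonempty[OF that] by blast
  then obtain x where x: "\<And>i. i \<in> pverts G \<Longrightarrow> x i \<in> pverts (\<Phi> i)" by metis
  have x_adj: "(v, x i) \<in> parcs P" if "(j, i) \<in> parcs G" "v \<in> pverts (\<Phi> j)" for i j v
    using parcs_product_iff[of j i v "x i"] that x base_arcsD(1,2) by blast
  define A where "A = {i \<in> I. (i, b) \<in> parcs G}"
  have acA: "{a, c} \<subseteq> A" using ac ab bc base_arcsD(4) unfolding A_def by blast
  have finI: "finite I" using I pair_graph_finite_pverts[OF base_graph] finite_subset by blast
  have finA: "finite A" "A \<subseteq> I" using finI unfolding A_def by auto
  have finS: "finite (S i)" if "i \<in> I" for i
    using that I S_sub[of i] pair_graph_finite_pverts[OF factor_graph] finite_subset by blast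
  let ?S = "\<Union>i\<in>I. S i" and ?T = "x ` insert b A \<union> (\<Union>i\<in>I - A. S i)"
  have "minimal_total_dominating P ?S"
    using minimal_total_dominating_UN_maximal_independent[OF I indep maximal] S I by blast
  moreover have "total_dominating P ?T"
    unfolding total_dominating_def
  proof (intro conjI ballI)
    have "x ` insert b A \<subseteq> pverts P" using x abc I finA(2) unfolding pverts_product by blast
    moreover have "(\<Union>i\<in>I - A. S i) \<subseteq> pverts P" using S_sub I unfolding pverts_product by blast
    ultimately show "?T \<subseteq> pverts P" by blast
    fix v assume "v \<in> pverts P"
    then obtain j where j: "j \<in> pverts G" "v \<in> pverts (\<Phi> j)" by (auto simp: pverts_product)
    consider "j \<in> A" | "j \<in> I - A" | "j \<in> pverts G - I" using j(1) by blast
    then show "\<exists>u\<in>?T. (v, u) \<in> parcs P"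
    proof cases
      case 1
      \<comment> \<open>A factor in \<open>A\<close> has lost its own dominating set; the new vertex
        \<open>x b\<close> dominates it instead.\<close>
      then show ?thesis using x_adj[of j b v] j unfolding A_def by blast
    next
      case 2
      then obtain u where "u \<in> S j" "(v, u) \<in> parcs (\<Phi> j)"
        using S_td[OF j(1)] j unfolding total_dominating_def by blast
      then show ?thesis using 2 j by (auto simp: gen_lex_product_def)
    next
      case 3
      \<comment> \<open>Outside \<open>I\<close>, including at \<open>b\<close> itself, any one
        vertex of an adjacent factor suffices: \<open>x i\<close> if \<open>i \<in> A\<close>, an
        element of \<open>S i\<close> otherwise.\<close>
      then obtain i where i: "i \<in> I" "(j, i) \<in> parcs G" using maximal by blast
      show ?thesis
      proof (cases "i \<in> A")
        case True
        then show ?thesis using x_adj[OF i(2) j(2)] by blast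
      next
        case False
        have iG: "i \<in> pverts G" using i I by blast
        obtain u where u: "u \<in> S i"
          using S_td[OF iG] factor_nonempty[OF iG] unfolding total_dominating_def by blast
        then have "(v, u) \<in> parcs P"
          using parcs_product_iff[OF j(1) iG j(2), of u] i S_sub[OF iG] by blast
        with u i False show ?thesis by blast
      qed
    qed
  qed
  moreover have "card ?T < card ?S"
  proof -
    have "2 \<le> card A" using card_mono[OF finA(1) acA] assms(3) by simp
    have "card ?T \<le> card (x ` insert b A) + card (\<Union>i\<in>I - A. S i)" by (rule card_Un_le)
    also have "\<dots> \<le> (card A + 1) + (\<Sum>i\<in>I - A. card (S i))"
    proof (rule add_mono)
      show "card (x ` insert b A) \<le> card A + 1"
        using card_image_le[of "insert b A" x] card_insert_le_m1[of "card A + 1" A b] finA(1)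
        by auto
      show "card (\<Union>i\<in>I - A. S i) \<le> (\<Sum>i\<in>I - A. card (S i))"
        using finI by (intro card_UN_le) auto
    qed
    \<comment> \<open>Each \<open>S i\<close> has at least two elements, and
      \<open>card A + 1 < 2 * card A\<close> because \<open>A\<close> contains both \<open>a\<close>
      and \<open>c\<close>.\<close>
    also have "\<dots> < (\<Sum>i\<in>A. card (S i)) + (\<Sum>i\<in>I - A. card (S i))"
    proof -
      have "2 \<le> card (S i)" if "i \<in> A" for i
      proof -
        have "i \<in> pverts G" using that finA(2) I by blast
        then show ?thesis
          using card_total_dominating_ge_2 factor_graph factor_nonempty S_td by blast
      qed
      then have "card A * 2 \<le> (\<Sum>i\<in>A. card (S i))"
        using sum_bounded_below[of A 2 "\<lambda>i. card (S i)"] by simp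
      with \<open>2 \<le> card A\<close> show ?thesis by linarith
    qed
    also have "\<dots> = (\<Sum>i\<in>I. card (S i))"
      using sum.subset_diff[OF finA(2) finI, of "\<lambda>i. card (S i)"] by simp
    also have "\<dots> = card ?S"
    proof (rule card_UN_disjoint[symmetric])
      show "\<forall>i\<in>I. \<forall>j\<in>I. i \<noteq> j \<longrightarrow> S i \<inter> S j = {}"
        using S_sub same_factor I by (meson disjoint_iff subsetD)
    qed (use finI finS in auto)
    finally show ?thesis .
  qed
  ultimately show thesis by (rule that)
qed

text \<open>A missing edge yields an induced path and hence a total dominating set \<open>T\<close>
  smaller than a minimal one; a minimal set inside \<open>T\<close> then violates equal
  cardinality.\<close>

lemma well_total_dominated_product_imp_complete:
  assumes "well_total_dominated P" "Digraph_Component.connected (with_proj G)"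
    and "i \<in> pverts G" "j \<in> pverts G" "i \<noteq> j"
  shows "(i, j) \<in> parcs G"
proof (rule ccontr)
  assume "(i, j) \<notin> parcs G"
  then obtain a b c where "(a, b) \<in> parcs G" "(b, c) \<in> parcs G" "a \<noteq> c" "(a, c) \<notin> parcs G"
    using induced_path_exists[OF base_graph assms(2-5)] by blast
  then obtain S T where S: "minimal_total_dominating P S"
    and T: "total_dominating P T" "card T < card S"
    using induced_path_imp_smaller_total_dominating by blast
  obtain R where R: "minimal_total_dominating P R" "R \<subseteq> T"
    using minimal_total_dominating_subset_exists[OF product_graph T(1)] .
  have "finite T"
    using T(1) pair_graph_finite_pverts[OF product_graph] finite_subset
    unfolding total_dominating_def by blast
  then have "card R < card S" using card_mono[OF _ R(2)] T(2) by linarith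
  moreover have "card R = card S"
    using well_total_dominated_iff_card[OF product_graph T(1), of "\<gamma>\<^sub>t P"] assms(1) S R(1)
    by metis
  ultimately show False by simp
qed

section \<open>Complete base graphs and the characterization\<close>

text \<open>Minimal sets contained in one factor are exactly the minimal sets of that factor. Any
  other minimal set contains a pair from two different factors, which already dominates, and so
  equals this pair.\<close>

lemma minimal_total_dominating_product_card_2_iff:
  assumes complete: "\<And>i j. i \<in> pverts G \<Longrightarrow> j \<in> pverts G \<Longrightarrow> i \<noteq> j \<Longrightarrow> (i, j) \<in> parcs G"
    and "pverts G \<noteq> {}"
  shows "(\<forall>S. minimal_total_dominating P S \<longrightarrow> card S = 2) \<longleftrightarrow>
    (\<forall>i\<in>pverts G. \<forall>S. minimal_total_dominating (\<Phi> i) S \<longrightarrow> card S = 2)"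
proof
  assume L: "\<forall>S. minimal_total_dominating P S \<longrightarrow> card S = 2"
  show "\<forall>i\<in>pverts G. \<forall>S. minimal_total_dominating (\<Phi> i) S \<longrightarrow> card S = 2"
  proof (intro ballI allI impI)
    fix i S assume i: "i \<in> pverts G" and S: "minimal_total_dominating (\<Phi> i) S"
    then have "S \<subseteq> pverts (\<Phi> i)" unfolding minimal_total_dominating_def total_dominating_def by blast
    then show "card S = 2"
      using minimal_total_dominating_product_in_factor_iff[OF i, of S] complete i S L by blast
  qed
next
  assume R: "\<forall>i\<in>pverts G. \<forall>S. minimal_total_dominating (\<Phi> i) S \<longrightarrow> card S = 2"
  show "\<forall>S. minimal_total_dominating P S \<longrightarrow> card S = 2"
  proof (intro allI impI)
    fix S assume S: "minimal_total_dominating P S"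
    then have sub: "S \<subseteq> pverts P" and td: "total_dominating P S"
      unfolding minimal_total_dominating_def total_dominating_def by auto
    show "card S = 2"
    proof (cases "\<exists>i\<in>pverts G. S \<subseteq> pverts (\<Phi> i)")
      case True
      then obtain i where i: "i \<in> pverts G" "S \<subseteq> pverts (\<Phi> i)" by blast
      then show ?thesis
        using minimal_total_dominating_product_in_factor_iff[of i S] complete S R by blast
    next
      case False
      have "pverts P \<noteq> {}" using factor_nonempty assms(2) by (auto simp: pverts_product)
      then obtain x where x: "x \<in> S" using td unfolding total_dominating_def by blast
      then obtain i where i: "i \<in> pverts G" "x \<in> pverts (\<Phi> i)"
        using sub by (auto simp: pverts_product)
      obtain y where y: "y \<in> S" "y \<notin> pverts (\<Phi> i)"
        using i False by blast
      then obtain j where j: "j \<in> pverts G" "y \<in> pverts (\<Phi> j)"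
        using sub by (auto simp: pverts_product)
      have "i \<noteq> j" using y j by blast
      then have "total_dominating P {x, y}"
        using total_dominating_cross_pair complete i j by blast
      then have "\<not> {x, y} \<subset> S" using S unfolding minimal_total_dominating_def by metis
      then have "S = {x, y}" using x y(1) by auto
      moreover have "x \<noteq> y" using i y by blast
      ultimately show ?thesis by simp
    qed
  qed
qed

text \<open>\<open>complete_digraph\<close> prescribes the arc set exactly; the inclusion of
  \<open>parcs G\<close> in all pairs of distinct vertices holds since \<open>G\<close> is
  loop-free.\<close>

lemma complete_digraph_iff:
  "complete_digraph (card (pverts G)) (with_proj G) \<longleftrightarrow>
    (\<forall>i\<in>pverts G. \<forall>j\<in>pverts G. i \<noteq> j \<longrightarrow> (i, j) \<in> parcs G)"
proof -
  have "parcs G \<subseteq> {(u, v). (u, v) \<in> pverts G \<times> pverts G \<and> u \<noteq> v}"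
    using base_arcsD(1-3) by blast
  then have "parcs G = {(u, v). (u, v) \<in> pverts G \<times> pverts G \<and> u \<noteq> v} \<longleftrightarrow>
      (\<forall>i\<in>pverts G. \<forall>j\<in>pverts G. i \<noteq> j \<longrightarrow> (i, j) \<in> parcs G)"
    by blast
  then show ?thesis
    by (simp add: complete_digraph_pair_def pair_graph_finite_pverts[OF base_graph])
qed

theorem well_total_dominated_product:
  assumes "Digraph_Component.connected (with_proj G)" "2 \<le> card (pverts G)"
  shows "well_total_dominated P \<longleftrightarrow> complete_digraph (card (pverts G)) (with_proj G) \<and>
      (\<forall>i\<in>pverts G. well_total_dominated (\<Phi> i) \<and> \<gamma>\<^sub>t (\<Phi> i) = 2)"
    and "well_total_dominated P \<Longrightarrow> \<gamma>\<^sub>t P = 2"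
proof -
  have td: "total_dominating P (pverts P)"
    using total_dominating_pverts product_graph product_no_isolated by blast
  note P_iff = well_total_dominated_iff_card[OF product_graph td]
  have factor_iff: "well_total_dominated (\<Phi> i) \<and> \<gamma>\<^sub>t (\<Phi> i) = 2 \<longleftrightarrow>
      (\<forall>S. minimal_total_dominating (\<Phi> i) S \<longrightarrow> card S = 2)" if "i \<in> pverts G" for i
    using well_total_dominated_iff_card factor_graph factor_total_dominating that by blast
  obtain p q where pq: "p \<in> pverts G" "q \<in> pverts G" "p \<noteq> q"
    using assms(2) card_le_Suc0_iff_eq[OF pair_graph_finite_pverts[OF base_graph]] by fastforce
  have main: "well_total_dominated P \<and> \<gamma>\<^sub>t P = 2 \<longleftrightarrow>
      (\<forall>i\<in>pverts G. well_total_dominated (\<Phi> i) \<and> \<gamma>\<^sub>t (\<Phi> i) = 2)"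
    if "complete_digraph (card (pverts G)) (with_proj G)"
  proof -
    have "well_total_dominated P \<and> \<gamma>\<^sub>t P = 2 \<longleftrightarrow>
        (\<forall>i\<in>pverts G. \<forall>S. minimal_total_dominating (\<Phi> i) S \<longrightarrow> card S = 2)"
      unfolding P_iff
      by (rule minimal_total_dominating_product_card_2_iff)
         (use that complete_digraph_iff pq in auto)
    then show ?thesis using factor_iff by blast
  qed
  \<comment> \<open>Once \<open>G\<close> is complete, a pair from the factors \<open>p\<close> and
    \<open>q\<close> is total dominating. A minimal set inside it has at most two elements, and no
    total dominating set has fewer; well-domination identifies this size with
    \<open>\<gamma>\<^sub>t P\<close>.\<close>
  have necessary: "complete_digraph (card (pverts G)) (with_proj G) \<and> \<gamma>\<^sub>t P = 2" if well: "well_total_dominated P"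
  proof
    show compl: "complete_digraph (card (pverts G)) (with_proj G)"
      using complete_digraph_iff well_total_dominated_product_imp_complete[OF well assms(1)] by blast
    obtain x y where xy: "x \<in> pverts (\<Phi> p)" "y \<in> pverts (\<Phi> q)" using factor_nonempty pq by blast
    have "total_dominating P {x, y}"
      by (rule total_dominating_cross_pair[OF _ pq xy]) (use compl complete_digraph_iff in blast)
    then obtain S where S: "minimal_total_dominating P S" "S \<subseteq> {x, y}"
      using minimal_total_dominating_subset_exists[OF product_graph] by blast
    have "card S \<le> 2"
      using card_mono[OF _ S(2)] by (auto simp: card_insert_if split: if_splits)
    moreover have "pverts P \<noteq> {}" using xy pq by (auto simp: pverts_product)
    then have "2 \<le> card S"
      using card_total_dominating_ge_2[OF product_graph] S(1)
      unfolding minimal_total_dominating_def by blast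
    moreover have "card S = \<gamma>\<^sub>t P" using P_iff well S(1) by blast
    ultimately show "\<gamma>\<^sub>t P = 2" by simp
  qed
  show "well_total_dominated P \<Longrightarrow> \<gamma>\<^sub>t P = 2" using necessary by blast
  show "well_total_dominated P \<longleftrightarrow> complete_digraph (card (pverts G)) (with_proj G) \<and>
      (\<forall>i\<in>pverts G. well_total_dominated (\<Phi> i) \<and> \<gamma>\<^sub>t (\<Phi> i) = 2)"
    using necessary main by metis
qed

end

theorem theorem3p9:
  fixes n :: nat
    and G :: "nat pair_pre_digraph"
    and \<Phi> :: "nat \<Rightarrow> 'a pair_pre_digraph"
  assumes "n \<ge> 2"
    and "pair_graph G"
    and "pverts G = {1..n}"
    and "Digraph_Component.connected (with_proj G)"
    and "\<And>i. i \<in> {1..n} \<Longrightarrow> pair_graph (\<Phi> i)"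
    and "\<And>i. i \<in> {1..n} \<Longrightarrow> pverts (\<Phi> i) \<noteq> {}"
    and "disjoint_family_on (\<lambda>i. pverts (\<Phi> i)) {1..n}"
    and "\<And>i. i \<in> {1..n} \<Longrightarrow> min_degree (\<Phi> i) \<ge> 1"
  shows "(well_total_dominated (gen_lex_product G \<Phi>) \<longleftrightarrow>
            complete_digraph n (with_proj G) \<and>
            (\<forall>i\<in>{1..n}. well_total_dominated (\<Phi> i) \<and> \<gamma>\<^sub>t (\<Phi> i) = 2)) \<and>
         (well_total_dominated (gen_lex_product G \<Phi>) \<longrightarrow> \<gamma>\<^sub>t (gen_lex_product G \<Phi>) = 2)"
proof -
  have "lex_product G \<Phi>"
  proof (rule lex_product.intro; (unfold assms(3))?)
    show "\<exists>u. (v, u) \<in> parcs (\<Phi> i)" if "i \<in> {1..n}" "v \<in> pverts (\<Phi> i)" for i v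
      using min_degree_ge_1_imp_adjacent[OF assms(5)[OF that(1)] assms(8)[OF that(1)] that(2)] .
  qed (fact assms)+
  from lex_product.well_total_dominated_product[OF this assms(4)] show ?thesis
    using assms(1) by (simp add: assms(3))
qed

end
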